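(* Let $m<n$ be positive integers. Let $D\subsetneq\mathbb{C}^m$ be a strongly hyperconvex Lipschitz domain such that $\partial D$ is a Lipschitz manifold, and let $\Omega\subsetneq\mathbb{C}^n$ be a regular strongly hyperconvex Lipschitz domain such that $\partial\Omega$ is a Lipschitz manifold. Let $F=(F_1,\dots,F_n):D\to\Omega$ be a proper holomorphic map, and assume that there exists some $p>m$ such that $$\frac{\partial F_\mu}{\partial z_j}\,\overline{\frac{\partial F_\nu}{\partial z_k}}\in\mathbb{L}^p(D,\mathsf{m}_{2m})$$ for all $j,k$ with $1\leq j,k\leq m$ and all $\mu,\nu$ with $1\leq\mu,\nu\leq n$. Then $F$ extends to a continuous map $\widetilde F:\overline D\to\overline\Omega$ with $\widetilde F(\partial D)\subseteq\partial\Omega$.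
   Context: $\mathsf{m}_{2m}$ denotes the $2m$-dimensional Lebesgue measure on $\mathbb{C}^m\cong\mathbb{R}^{2m}$. The normalisation of $dd^c$ is $dd^cu=\frac i2\sum_{j,k}\frac{\partial^2u}{\partial z_j\partial\bar z_k}dz_j\wedge d\bar z_k$ (in the sense of currents). Strongly hyperconvex Lipschitz domain (Charabati): a bounded domain $G\subsetneq\mathbb{C}^N$ for which there exist a neighbourhood $U$ of $\overline G$ and a Lipschitz plurisubharmonic function $\rho:U\to\mathbb{R}$ such that (1) $\rho<0$ in $G$ and $\partial G=\{z\in U:\rho(z)=0\}$; (2) there is a constant $c>0$ such that $dd^c\rho\geq c\,\omega_N$ on $G$ in the sense of currents, where $\omega_N=\frac i2\sum_{j=1}^N dz_j\wedge d\bar z_j$. Regular strongly hyperconvex Lipschitz domain: a bounded domain $G\subsetneq\mathbb{C}^N$ for which there exist a neighbourhood $U$ of $\overline G$ and a Lipschitz plurisubharmonic function $\rho:U\to\mathbb{R}$ such that (1) $\rho<0$ in $G$ and $\partial G=\{z\in U:\rho(z)=0\}$; (2) there is a constant $c>0$ such that $dd^c\rho\geq c\,\omega_N$ on $G$ in the sense of currents, where $\omega_N=\frac i2\sum_{j=1}^N dz_j\wedge d\bar z_j$; and (3) writing $dd^c\rho=\sum_{\mu,\nu=1}^N b_{\mu\bar\nu}\,dz_\mu\wedge d\bar z_\nu$, each $b_{\mu\bar\nu}\in\mathbb{L}^\infty(G)$ (essentially bounded with respect to Lebesgue measure). Lipschitz manifold: the boundary of a domain $G\subsetneq\mathbb{C}^N$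 is a Lipschitz manifold if, for each $p\in\partial G$, there exist a neighbourhood $\mathcal{V}_p$ of $p$, a unitary map $\mathsf{U}_p$, and a Lipschitz function $\varphi_p$ whose domain $\mathsf{dom}(\varphi_p)$ is an open neighbourhood of the origin in $\mathbb{R}^{2N-1}\cong\mathbb{C}^{N-1}\times\mathbb{R}$ such that, writing $\mathsf{U}^p(z):=\mathsf{U}_p(z-p)$ and $\mathsf{z}=(\mathsf{z}',\mathsf{z}_N)=\mathsf{U}^p(z)\in\mathbb{C}^{N-1}\times\mathbb{C}$, $$\mathsf{U}^p(\mathcal{V}_p\cap G)=\{(\mathsf{z}',\mathsf{z}_N)\in\mathsf{U}^p(\mathcal{V}_p):\ \mathrm{Im}(\mathsf{z}_N)>\varphi_p(\mathsf{z}',\mathrm{Re}(\mathsf{z}_N)),\ (\mathsf{z}',\mathrm{Re}(\mathsf{z}_N))\in\mathsf{dom}(\varphi_p)\},$$ $$\mathsf{U}^p(\mathcal{V}_p\cap\partial G)=\{(\mathsf{z}',\mathsf{z}_N)\in\mathbb{C}^{N-1}\times\mathbb{C}:\ \mathrm{Im}(\mathsf{z}_N)=\varphi_p(\mathsf{z}',\mathrm{Re}(\mathsf{z}_N)),\ (\mathsf{z}',\mathrm{Re}(\mathsf{z}_N))\in\mathsf{dom}(\varphi_p)\}.$$ *)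

theory Defs
  imports "HOL-Analysis.Analysis"
begin

text \<open>
  The space \<open>\<complex>\<^sup>N\<close> is \<open>complex ^ 'n\<close> with \<open>N = CARD('n)\<close>. Its Lebesgue measure \<open>lebesgue\<close> is
  the \<open>2N\<close>-dimensional one of the underlying real Euclidean space.
\<close>

definition wirt :: "'n \<Rightarrow> (complex ^ 'n \<Rightarrow> complex) \<Rightarrow> complex ^ 'n \<Rightarrow> complex"
  where \<comment> \<open>\<open>\<partial>f / \<partial>z\<^sub>j\<close>\<close>
  "wirt j f z = (frechet_derivative f (at z) (axis j 1)
                 - \<i> * frechet_derivative f (at z) (axis j \<i>)) / 2"

definition wirt_bar :: "'n \<Rightarrow> (complex ^ 'n \<Rightarrow> complex) \<Rightarrow> complex ^ 'n \<Rightarrow> complex"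
  where \<comment> \<open>\<open>\<partial>f / \<partial>(cnj z\<^sub>j)\<close>\<close>
  "wirt_bar j f z = (frechet_derivative f (at z) (axis j 1)
                     + \<i> * frechet_derivative f (at z) (axis j \<i>)) / 2"

definition holomorphic_map_on :: "(complex ^ 'm) set \<Rightarrow> (complex ^ 'm \<Rightarrow> complex ^ 'n) \<Rightarrow> bool"
  where
  "holomorphic_map_on D F \<longleftrightarrow>
     (\<forall>z\<in>D. \<exists>A. (F has_derivative A) (at z) \<and> Vector_Spaces.linear (*s) (*s) A)"

primrec C_diff :: "nat \<Rightarrow> ('a::real_normed_vector \<Rightarrow> 'b::real_normed_vector) \<Rightarrow> bool"
  where
  "C_diff 0 f \<longleftrightarrow> continuous_on UNIV f"
| "C_diff (Suc r) f \<longleftrightarrow>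
     (\<forall>x. f differentiable (at x)) \<and> (\<forall>v. C_diff r (\<lambda>x. frechet_derivative f (at x) v))"

definition test_function_on :: "(complex ^ 'n) set \<Rightarrow> (complex ^ 'n \<Rightarrow> complex) \<Rightarrow> bool"
  where
  "test_function_on G \<phi> \<longleftrightarrow>
     (\<forall>r. C_diff r \<phi>) \<and> compact (closure {z. \<phi> z \<noteq> 0}) \<and> closure {z. \<phi> z \<noteq> 0} \<subseteq> G"

text \<open>
  For real-valued (nowhere \<open>-\<infinity>\<close>) functions the circle means in the sub-mean value inequality are
  automatically finite; the integrability clause says this explicitly, because the Bochner integral
  of a non-integrable function is \<open>0\<close> in the library.
\<close>

definition plurisubharmonic_on :: "(complex ^ 'n) set \<Rightarrow> (complex ^ 'n \<Rightarrow> real) \<Rightarrow> bool"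
  where
  "plurisubharmonic_on U u \<longleftrightarrow>
     (\<forall>t. openin (top_of_set U) {z \<in> U. u z < t}) \<and>
     (\<forall>a b. (\<forall>\<zeta>::complex. cmod \<zeta> \<le> 1 \<longrightarrow> a + \<zeta> *s b \<in> U) \<longrightarrow>
        set_integrable lborel {0..2*pi} (\<lambda>\<theta>. u (a + cis \<theta> *s b)) \<and>
        u a \<le> (LINT \<theta>:{0..2*pi}|lborel. u (a + cis \<theta> *s b)) / (2 * pi))"

text \<open>
  A current \<open>\<Sum>\<^sub>j\<^sub>,\<^sub>k T\<^sub>j\<^sub>k dz\<^sub>j \<and> d(cnj z\<^sub>k)\<close> of bidegree (1,1) is given by its coefficients \<open>T\<^sub>j\<^sub>k\<close>, which
  are distributions, i.e. functionals on test functions; a locally integrable function \<open>g\<close> is the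
  distribution \<open>\<phi> \<mapsto> \<integral> g \<phi>\<close>.
\<close>

type_synonym 'n current11 = "'n \<Rightarrow> 'n \<Rightarrow> (complex ^ 'n \<Rightarrow> complex) \<Rightarrow> complex"

text \<open>
  \<open>dd\<^sup>c u = (i/2) \<Sum> \<partial>\<^sup>2u/(\<partial>z\<^sub>j \<partial>(cnj z\<^sub>k)) dz\<^sub>j \<and> d(cnj z\<^sub>k)\<close>, the derivatives being those of distributions on
  \<open>G\<close>; moving two derivatives onto the test function produces no sign.
\<close>

definition ddc :: "(complex ^ 'n) set \<Rightarrow> (complex ^ 'n \<Rightarrow> real) \<Rightarrow> ('n::finite) current11"
  where
  "ddc G u j k \<phi> =
     \<i> / 2 * (LINT z|lebesgue_on G. complex_of_real (u z) * wirt j (wirt_bar k \<phi>) z)"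

definition omega :: "(complex ^ 'n) set \<Rightarrow> ('n::finite) current11"
  where \<comment> \<open>\<open>(i/2) \<Sum>\<^sub>j dz\<^sub>j \<and> d(cnj z\<^sub>j)\<close>\<close>
  "omega G j k \<phi> = (if j = k then \<i> / 2 * (LINT z|lebesgue_on G. \<phi> z) else 0)"

text \<open>
  A form \<open>(i/2) \<Sum> h\<^sub>j\<^sub>k dz\<^sub>j \<and> d(cnj z\<^sub>k)\<close> is positive iff \<open>\<Sum> h\<^sub>j\<^sub>k \<xi>\<^sub>j cnj(\<xi>\<^sub>k) \<ge> 0\<close> for all \<open>\<xi>\<close>; for
  currents this is read as positivity of a distribution. The factor \<open>2/i\<close> passes from
  the coefficients of \<open>dz\<^sub>j \<and> d(cnj z\<^sub>k)\<close> to \<open>h\<^sub>j\<^sub>k\<close>.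
\<close>

definition positive_current_on :: "(complex ^ 'n) set \<Rightarrow> ('n::finite) current11 \<Rightarrow> bool"
  where
  "positive_current_on G T \<longleftrightarrow>
     (\<forall>\<xi> :: complex ^ 'n. \<forall>\<phi>. test_function_on G \<phi> \<and> (\<forall>z. \<phi> z \<in> \<real>\<^sub>\<ge>\<^sub>0) \<longrightarrow>
        2 / \<i> * (\<Sum>j\<in>UNIV. \<Sum>k\<in>UNIV. T j k \<phi> * (\<xi> $ j) * cnj (\<xi> $ k)) \<in> \<real>\<^sub>\<ge>\<^sub>0)"

definition current_ge_on :: "(complex ^ 'n) set \<Rightarrow> ('n::finite) current11 \<Rightarrow> 'n current11 \<Rightarrow> bool"
  where
  "current_ge_on G S T \<longleftrightarrow> positive_current_on G (\<lambda>j k \<phi>. S j k \<phi> - T j k \<phi>)"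

definition L_infinity_on :: "(complex ^ 'n) set \<Rightarrow> (complex ^ 'n \<Rightarrow> complex) \<Rightarrow> bool"
  where
  "L_infinity_on G b \<longleftrightarrow>
     b \<in> borel_measurable (lebesgue_on G) \<and> (\<exists>M. AE z in lebesgue_on G. cmod (b z) \<le> M)"

definition L_p_on :: "real \<Rightarrow> (complex ^ 'n) set \<Rightarrow> (complex ^ 'n \<Rightarrow> complex) \<Rightarrow> bool"
  where
  "L_p_on p G f \<longleftrightarrow>
     f \<in> borel_measurable (lebesgue_on G) \<and> integrable (lebesgue_on G) (\<lambda>z. cmod (f z) powr p)"

definition bounded_proper_domain :: "(complex ^ 'n) set \<Rightarrow> bool"
  where
  "bounded_proper_domain G \<longleftrightarrow>
     open G \<and> connected G \<and> G \<noteq> {} \<and> G \<noteq> UNIV \<and> bounded G"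

definition shL_defining ::
    "(complex ^ 'n) set \<Rightarrow> (complex ^ 'n) set \<Rightarrow> (complex ^ 'n \<Rightarrow> real) \<Rightarrow> bool"
  where
  "shL_defining G U \<rho> \<longleftrightarrow>
     open U \<and> closure G \<subseteq> U \<and>
     (\<exists>L. L-lipschitz_on U \<rho>) \<and> plurisubharmonic_on U \<rho> \<and>
     (\<forall>z\<in>G. \<rho> z < 0) \<and> frontier G = {z \<in> U. \<rho> z = 0} \<and>
     (\<exists>c>0. current_ge_on G (ddc G \<rho>) (\<lambda>j k \<phi>. complex_of_real c * omega G j k \<phi>))"

definition strongly_hyperconvex_Lipschitz :: "(complex ^ 'n) set \<Rightarrow> bool"
  where
  "strongly_hyperconvex_Lipschitz G \<longleftrightarrow>
     bounded_proper_domain G \<and> (\<exists>U \<rho>. shL_defining G U \<rho>)"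

definition regular_strongly_hyperconvex_Lipschitz :: "(complex ^ 'n) set \<Rightarrow> bool"
  where
  "regular_strongly_hyperconvex_Lipschitz G \<longleftrightarrow>
     bounded_proper_domain G \<and>
     (\<exists>U \<rho>. shL_defining G U \<rho> \<and>
        (\<exists>b :: 'n \<Rightarrow> 'n \<Rightarrow> complex ^ 'n \<Rightarrow> complex. \<forall>\<mu> \<nu>.
            L_infinity_on G (b \<mu> \<nu>) \<and>
            (\<forall>\<phi>. test_function_on G \<phi> \<longrightarrow>
               ddc G \<rho> \<mu> \<nu> \<phi> = (LINT z|lebesgue_on G. b \<mu> \<nu> z * \<phi> z))))"

definition unitary_map :: "(complex ^ 'n \<Rightarrow> complex ^ 'n) \<Rightarrow> bool"
  where
  "unitary_map A \<longleftrightarrow> Vector_Spaces.linear (*s) (*s) A \<and>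
     (\<forall>z w. (\<Sum>j\<in>UNIV. A z $ j * cnj (A w $ j)) = (\<Sum>j\<in>UNIV. z $ j * cnj (w $ j)))"

text \<open>
  An abstract index type has no last element, so some index \<open>k\<close> plays the role of \<open>N\<close>. Which one is
  immaterial, as permutations of the coordinates are unitary and can be absorbed into \<open>A\<close>.
  The space \<open>\<complex>\<^sup>N\<^sup>-\<^sup>1 \<times> \<real>\<close> is the real hyperplane \<open>{w. Im (w $ k) = 0}\<close>, and
  \<open>flat k z\<close> is the point \<open>(z', Re z\<^sub>N)\<close> of it.
\<close>

definition flat :: "'n \<Rightarrow> complex ^ 'n \<Rightarrow> complex ^ 'n"
  where
  "flat k z = (\<chi> j. if j = k then complex_of_real (Re (z $ j)) else z $ j)"

definition Lipschitz_manifold_boundary :: "(complex ^ 'n) set \<Rightarrow> bool"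
  where
  "Lipschitz_manifold_boundary G \<longleftrightarrow>
     (\<forall>p \<in> frontier G. \<exists>V A k (dom\<phi> :: (complex ^ 'n) set) (\<phi> :: complex ^ 'n \<Rightarrow> real).
        open V \<and> p \<in> V \<and> unitary_map A \<and>
        openin (top_of_set {w. Im (w $ k) = 0}) dom\<phi> \<and> 0 \<in> dom\<phi> \<and>
        (\<exists>L. L-lipschitz_on dom\<phi> \<phi>) \<and>
        (\<lambda>z. A (z - p)) ` (V \<inter> G) =
          {w \<in> (\<lambda>z. A (z - p)) ` V. flat k w \<in> dom\<phi> \<and> Im (w $ k) > \<phi> (flat k w)} \<and>
        (\<lambda>z. A (z - p)) ` (V \<inter> frontier G) =
          {w. flat k w \<in> dom\<phi> \<and> Im (w $ k) = \<phi> (flat k w)})"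

text \<open>
  For subsets of Euclidean spaces, the library's \<^const>\<open>proper_map\<close> is the usual notion for
  continuous maps: preimages of compact sets are compact.
\<close>

lemma proper_map_iff_compact_preimage:
  fixes f :: "'a::euclidean_space \<Rightarrow> 'b::euclidean_space"
  assumes "continuous_on S f" "f ` S \<subseteq> T"
  shows "proper_map (top_of_set S) (top_of_set T) f \<longleftrightarrow>
           (\<forall>K. compact K \<and> K \<subseteq> T \<longrightarrow> compact {x \<in> S. f x \<in> K})"
proof -
  have k: "k_space (top_of_set T)" "kc_space (top_of_set T)"
    by (simp_all add: metrizable_imp_k_space Hausdorff_imp_kc_space metrizable_imp_Hausdorff_space metrizable_space_subtopology
        metrizable_space_euclidean)
  have c: "continuous_map (top_of_set S) (top_of_set T) f"
    using assms by (auto simp: continuous_map_in_subtopology)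
  show ?thesis
  proof
    assume "proper_map (top_of_set S) (top_of_set T) f"
    then show "\<forall>K. compact K \<and> K \<subseteq> T \<longrightarrow> compact {x \<in> S. f x \<in> K}"
      by (auto simp: proper_map_alt compactin_subtopology)
  next
    assume *: "\<forall>K. compact K \<and> K \<subseteq> T \<longrightarrow> compact {x \<in> S. f x \<in> K}"
    show "proper_map (top_of_set S) (top_of_set T) f"
      by (rule compact_imp_proper_map) (use k c assms * in \<open>auto simp: compactin_subtopology\<close>)
  qed
qed

end

theory Submission
  imports Defs
begin

text \<open>
  The integrability hypothesis with \<open>j = k\<close> and \<open>\<mu> = \<nu>\<close> says that the gradient of \<open>F\<close> lies in \<open>L\<^sup>q\<close> with
  \<open>q = 2p\<close>, which exceeds the real dimension \<open>2m\<close>. A Lipschitz boundary gives a uniform interior cone at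
  every point of the domain near a given boundary point, so Morrey's inequality makes \<open>F\<close> locally
  Hoelder continuous up to the boundary. By compactness \<open>F\<close> is uniformly continuous, hence extends to the
  closure, and properness forces boundary points to go to boundary points.
\<close>

text \<open>Near the boundary \<open>D\<close> need not be convex, so two close points cannot be
  compared along the segment between them. Both are compared instead with the values of
  \<open>F\<close> on one ball, of radius equal to their distance \<open>d\<close>, which each of
  them sees along segments inside \<open>D\<close>; the cones provide this ball. Over these segments
  the gradient is sampled on copies of the ball shrunk by \<open>t\<close> towards one of the
  points, where its mean is at most of order \<open>(t * d) powr - (N / q)\<close>, with
  \<open>N\<close> the real dimension. This is integrable in \<open>t\<close> over the unit interval
  precisely when \<open>q > N\<close>, and multiplied by the segment length, of order
  \<open>d\<close>, it gives the Hoelder exponent \<open>1 - N / q\<close>.\<close>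

section \<open>Morrey's estimate on a ball visible from two points\<close>

text \<open>The bound \<open>g\<close> may fail to be integrable along an individual segment. With a
  nonnegative extended integral the inequality still holds on every segment, so it can be averaged
  without an exceptional set.\<close>

lemma norm_diff_le_nn_integral_segment:
  fixes f :: "'a::euclidean_space \<Rightarrow> 'b::banach" and g :: "'a \<Rightarrow> real"
  assumes deriv: "\<And>z. z \<in> closed_segment x y \<Longrightarrow> (f has_derivative f' z) (at z)"
    and bound: "\<And>z. z \<in> closed_segment x y \<Longrightarrow> norm (f' z (y - x)) \<le> g z * norm (y - x)"
    and g: "g \<in> borel_measurable borel" "\<And>z. 0 \<le> g z"
  shows "ennreal (norm (f y - f x))
    \<le> (\<integral>\<^sup>+t. ennreal (g (x + t *\<^sub>R (y - x)) * norm (y - x)) * indicator {0..1} t \<partial>lborel)"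
proof -
  define \<gamma> where "\<gamma> t = x + t *\<^sub>R (y - x)" for t :: real
  define G where "G t = g (\<gamma> t) * norm (y - x) * indicator {0..1} t" for t
  have seg: "\<gamma> t \<in> closed_segment x y" if "t \<in> {0..1}" for t
    using that by (auto simp: closed_segment_def \<gamma>_def algebra_simps intro!: exI[of _ t])
  have [measurable]: "\<gamma> \<in> borel_measurable borel"
    unfolding \<gamma>_def by (intro borel_measurable_continuous_onI continuous_intros)
  note g(1)[measurable]
  have G_meas: "G \<in> borel_measurable borel"
    unfolding G_def by measurable
  have G0: "0 \<le> G t" for t
    using g(2) by (simp add: G_def)
  \<comment> \<open>The gauge integral recovers a function from its pointwise derivative; a Lebesgue
    integral would require that derivative to be integrable.\<close>
  have ftc: "((\<lambda>t. f' (\<gamma> t) (y - x)) has_integral f (\<gamma> 1) - f (\<gamma> 0)) {0..1}"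
  proof (rule fundamental_theorem_of_calculus)
    fix t :: real assume t: "t \<in> {0..1}"
    have "(f \<circ> \<gamma> has_derivative f' (\<gamma> t) \<circ> (\<lambda>s. s *\<^sub>R (y - x))) (at t within {0..1})"
    proof (rule diff_chain_within)
      show "(\<gamma> has_derivative (\<lambda>s. s *\<^sub>R (y - x))) (at t within {0..1})"
        unfolding \<gamma>_def by (auto intro!: derivative_eq_intros)
      show "(f has_derivative f' (\<gamma> t)) (at (\<gamma> t) within \<gamma> ` {0..1})"
        using deriv[OF seg[OF t]] by (rule has_derivative_at_withinI)
    qed
    moreover have "f' (\<gamma> t) (s *\<^sub>R (y - x)) = s *\<^sub>R f' (\<gamma> t) (y - x)" for s
      using deriv[OF seg[OF t]] by (meson has_derivative_linear linear_cmul)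
    ultimately show "((\<lambda>t. f (\<gamma> t)) has_vector_derivative f' (\<gamma> t) (y - x)) (at t within {0..1})"
      by (simp add: has_vector_derivative_def o_def)
  qed simp
  show ?thesis
  \<comment> \<open>An infinite integral makes the claim trivial. A finite one makes
    \<open>G\<close> integrable, which is what allows the norm to be taken under the gauge
    integral.\<close>
  proof (cases "(\<integral>\<^sup>+t. ennreal (G t) \<partial>lborel) < \<infinity>")
    case True
    then have int: "G integrable_on UNIV"
      by (intro nn_integral_integrable_on G_meas G0)
    then have "(G has_integral integral UNIV G) UNIV" by blast
    then have nn: "(\<integral>\<^sup>+t. ennreal (G t) \<partial>lborel) = ennreal (integral UNIV G)"
      by (intro nn_integral_has_integral_lborel G_meas G0)
    have int01: "G integrable_on {0..1}"
      using int integrable_on_subinterval subset_UNIV by blast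
    have "f y - f x = integral {0..1} (\<lambda>t. f' (\<gamma> t) (y - x))"
      using integral_unique[OF ftc] by (simp add: \<gamma>_def)
    then have "norm (f y - f x) \<le> integral {0..1} G"
      using integral_norm_bound_integral[OF has_integral_integrable[OF ftc] int01] bound seg
      by (simp add: G_def)
    also have "\<dots> \<le> integral UNIV G"
      using int int01 G0 by (intro integral_subset_le) auto
    finally have "ennreal (norm (f y - f x)) \<le> (\<integral>\<^sup>+t. ennreal (G t) \<partial>lborel)"
      by (simp add: nn ennreal_leI)
    also have "\<dots> = (\<integral>\<^sup>+t. ennreal (g (\<gamma> t) * norm (y - x)) * indicator {0..1} t \<partial>lborel)"
      by (intro nn_integral_cong) (simp add: G_def split: split_indicator)
    finally show ?thesis by (simp add: \<gamma>_def)
  next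
    case False
    have "(\<integral>\<^sup>+t. ennreal (G t) \<partial>lborel)
        = (\<integral>\<^sup>+t. ennreal (g (\<gamma> t) * norm (y - x)) * indicator {0..1} t \<partial>lborel)"
      by (intro nn_integral_cong) (simp add: G_def split: split_indicator)
    with False show ?thesis
      by (simp add: \<gamma>_def less_top[symmetric])
  qed
qed

text \<open>
  Used with a free parameter \<open>l\<close>, this replaces Hoelder's inequality in the proof of Morrey's estimate.
\<close>

lemma powr_inverse_le_add:
  fixes a l q :: real
  assumes "0 \<le> a" "0 < l" "1 \<le> q"
  shows "a powr (1 / q) \<le> l + l powr (1 - q) * a"
proof (cases "a powr (1 / q) \<le> l")
  case True
  then show ?thesis using assms by (simp add: add_increasing2)
next
  case False
  define b where "b = a powr (1 / q)"
  have "b > l" "b > 0" using False assms by (auto simp: b_def)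
  have a: "a = b powr q" using assms by (simp add: b_def powr_powr)
  have "b = b powr (1 - q) * a" using \<open>b > 0\<close> by (simp add: a powr_add[symmetric])
  also have "\<dots> \<le> l powr (1 - q) * a"
    using assms \<open>b > l\<close> by (intro mult_right_mono powr_mono2') auto
  finally show ?thesis using assms by (simp add: b_def)
qed

text \<open>The Jacobian of a dilation by \<open>t\<close> is \<open>t ^ DIM('a)\<close>; its
  inverse is the source of the singularity at \<open>t = 0\<close> in Morrey's estimate.\<close>

lemma nn_integral_scale_ball_le:
  fixes h :: "'a::euclidean_space \<Rightarrow> real"
  assumes h: "h \<in> borel_measurable borel"
    and K: "(\<integral>\<^sup>+z. ennreal (h z) \<partial>lborel) \<le> ennreal K" "0 \<le> K" and t: "0 < t"
  shows "(\<integral>\<^sup>+w. ennreal (h (x + t *\<^sub>R (w - x))) \<partial>lborel) \<le> ennreal (K / t ^ DIM('a))"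
proof -
  note h[measurable]
  have "ennreal (t ^ DIM('a)) * (\<integral>\<^sup>+w. ennreal (h (x + t *\<^sub>R (w - x))) \<partial>lborel)
     = (\<integral>\<^sup>+z. ennreal (h z) \<partial>lborel)"
    using t by (subst (2) lborel_affine[of t "x - t *\<^sub>R x"])
      (simp_all add: nn_integral_density nn_integral_distr nn_integral_cmult algebra_simps)
  with K have "ennreal (t ^ DIM('a)) * (\<integral>\<^sup>+w. ennreal (h (x + t *\<^sub>R (w - x))) \<partial>lborel) \<le> ennreal K"
    by simp
  then have "ennreal (1 / t ^ DIM('a)) * (ennreal (t ^ DIM('a)) * (\<integral>\<^sup>+w. ennreal (h (x + t *\<^sub>R (w - x))) \<partial>lborel))
       \<le> ennreal (1 / t ^ DIM('a)) * ennreal K"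
    by (rule mult_left_mono) simp
  then show ?thesis
    using t K by (simp add: mult.assoc[symmetric] ennreal_mult[symmetric])
qed

text \<open>For \<open>\<alpha> = N / q\<close> this is the integral whose convergence requires
  \<open>q > N\<close>.\<close>

lemma nn_integral_powr_Icc_0_1:
  fixes \<alpha> :: real
  assumes "\<alpha> < 1"
  shows "(\<integral>\<^sup>+t. ennreal (t powr - \<alpha>) * indicator {0..1} t \<partial>lborel) = ennreal (1 / (1 - \<alpha>))"
proof -
  have "((\<lambda>t. t powr - \<alpha>) has_integral (1 / (1 - \<alpha>))) {0..1}"
    using has_integral_powr_from_0[of "-\<alpha>" 1] assms by (simp add: algebra_simps)
  then have "((\<lambda>t. if t \<in> {0..1} then t powr - \<alpha> else 0) has_integral (1 / (1 - \<alpha>))) UNIV"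
    by (simp only: has_integral_restrict_UNIV)
  then have "((\<lambda>t. t powr - \<alpha> * indicator {0..1} t) has_integral (1 / (1 - \<alpha>))) UNIV"
    by (rule has_integral_eq[rotated]) (simp split: split_indicator)
  from nn_integral_has_integral_lborel[OF _ _ this]
  have "(\<integral>\<^sup>+t. ennreal (t powr - \<alpha> * indicator {0..1} t) \<partial>lborel) = ennreal (1 / (1 - \<alpha>))"
    by simp
  moreover have "(\<integral>\<^sup>+t. ennreal (t powr - \<alpha> * indicator {0..1} t) \<partial>lborel)
     = (\<integral>\<^sup>+t. ennreal (t powr - \<alpha>) * indicator {0..1} t \<partial>lborel)"
    by (intro nn_integral_cong) (simp split: split_indicator)
  ultimately show ?thesis by simp
qed

text \<open>
  \<open>f\<close> is not assumed to be continuously differentiable, since holomorphy in several variables is given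
  pointwise. The choice \<open>l = (t * d) powr - (N / q)\<close> below balances the two terms of
  \<open>powr_inverse_le_add\<close> after integration over the ball shrunk by \<open>t\<close> towards \<open>x\<close>.
\<close>

lemma Morrey_mean_bound:
  fixes f :: "'a::euclidean_space \<Rightarrow> 'b::banach" and h :: "'a \<Rightarrow> real"
  defines "N \<equiv> real DIM('a)"
  assumes q: "N < q" and d: "0 < d" and \<rho>: "ball c d \<subseteq> cball x \<rho>"
    and seg: "\<And>w. w \<in> ball c d \<Longrightarrow> closed_segment x w \<subseteq> S"
    and deriv: "\<And>z. z \<in> S \<Longrightarrow> (f has_derivative f' z) (at z)"
    and bound: "\<And>z v. z \<in> S \<Longrightarrow> norm (f' z v) \<le> h z powr (1 / q) * norm v"
    and h: "h \<in> borel_measurable borel" "\<And>z. 0 \<le> h z"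
    and K: "(\<integral>\<^sup>+z. ennreal (h z) \<partial>lborel) \<le> ennreal K" "0 \<le> K"
  shows "(\<integral>\<^sup>+w. ennreal (norm (f w - f x)) * indicator (ball c d) w \<partial>lborel)
     \<le> ennreal (\<rho> * (unit_ball_vol N + K) / (1 - N / q) * d powr (N - N / q))"
proof -
  define \<alpha> where "\<alpha> = N / q"
  define B where "B = ball c d"
  have N1: "N \<ge> 1" using DIM_positive[where 'a='a] by (simp add: N_def Suc_le_eq)
  have q1: "1 \<le> q" using N1 q by simp
  have \<alpha>: "0 < \<alpha>" "\<alpha> < 1" using N1 q by (auto simp: \<alpha>_def)
  have \<alpha>q: "\<alpha> * q = N" using N1 q by (simp add: \<alpha>_def)
  have "c \<in> cball x \<rho>" by (rule subsetD[OF \<rho>]) (use d in simp)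
  then have \<rho>0: "0 \<le> \<rho>" by (metis mem_cball zero_le_dist order_trans)
  note h(1)[measurable]
  have [measurable]: "B \<in> sets borel" by (simp add: B_def)
  have pt: "ennreal (norm (f w - f x)) * indicator B w
     \<le> (\<integral>\<^sup>+t. ennreal (h (x + t *\<^sub>R (w - x)) powr (1 / q) * \<rho>) * indicator {0..1} t * indicator B w \<partial>lborel)" for w
  proof (cases "w \<in> B")
    case True
    have nw: "norm (w - x) \<le> \<rho>"
      using True \<rho> by (auto simp: B_def dist_norm norm_minus_commute subset_eq)
    have "ennreal (norm (f w - f x))
      \<le> (\<integral>\<^sup>+t. ennreal (h (x + t *\<^sub>R (w - x)) powr (1 / q) * norm (w - x)) * indicator {0..1} t \<partial>lborel)"
      using seg[of w] True by (intro norm_diff_le_nn_integral_segment[where f' = f' and g = "\<lambda>z. h z powr (1 / q)"])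
        (auto simp: B_def deriv bound subset_eq)
    also have "\<dots> \<le> (\<integral>\<^sup>+t. ennreal (h (x + t *\<^sub>R (w - x)) powr (1 / q) * \<rho>) * indicator {0..1} t \<partial>lborel)"
      using nw by (intro nn_integral_mono mult_right_mono ennreal_leI mult_left_mono) auto
    finally show ?thesis using True by simp
  qed simp
  \<comment> \<open>At \<open>t = 0\<close> the ball collapses to \<open>x\<close>, and
    \<open>K\<close> does not control \<open>h x\<close>; moreover the right-hand side vanishes
    there, as \<open>0 powr - \<alpha> = 0\<close>. The single value is discarded later as a null
    set.\<close>
  have inner: "(\<integral>\<^sup>+w. ennreal (h (x + t *\<^sub>R (w - x)) powr (1 / q) * \<rho>) * indicator {0..1} t * indicator B w \<partial>lborel)
     \<le> ennreal (\<rho> * (unit_ball_vol N + K) * d powr (N - \<alpha>)) * (ennreal (t powr - \<alpha>) * indicator {0..1} t)"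
    if "t \<noteq> 0" for t
  proof (cases "t \<in> {0..1}")
    case True
    with that have t: "0 < t" by auto
    define l where "l = (t * d) powr - \<alpha>"
    have l: "l > 0" using t d by (simp add: l_def)
    have "l powr (1 - q) = (t * d) powr (N - \<alpha>)"
      by (simp add: l_def powr_powr algebra_simps \<alpha>q)
    then have lq: "l powr (1 - q) / t ^ DIM('a) = l * d powr N"
      using t d by (simp add: l_def powr_diff powr_mult powr_minus N_def powr_realpow field_simps)
    have "(\<integral>\<^sup>+w. ennreal (h (x + t *\<^sub>R (w - x)) powr (1 / q) * \<rho>) * indicator {0..1} t * indicator B w \<partial>lborel)
       \<le> (\<integral>\<^sup>+w. ennreal \<rho> * (ennreal l * indicator B w + ennreal (l powr (1 - q)) * ennreal (h (x + t *\<^sub>R (w - x)))) \<partial>lborel)"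
    proof (rule nn_integral_mono)
      fix w
      have "ennreal (h (x + t *\<^sub>R (w - x)) powr (1 / q) * \<rho>)
        \<le> ennreal (\<rho> * (l + l powr (1 - q) * h (x + t *\<^sub>R (w - x))))"
        using mult_left_mono[OF powr_inverse_le_add[OF h(2) l q1] \<rho>0, of "x + t *\<^sub>R (w - x)"]
        by (intro ennreal_leI) (simp only: mult.commute)
      also have "\<dots> = ennreal \<rho> * (ennreal l + ennreal (l powr (1 - q)) * ennreal (h (x + t *\<^sub>R (w - x))))"
        using \<rho>0 l h(2) by (simp add: ennreal_mult)
      finally show "ennreal (h (x + t *\<^sub>R (w - x)) powr (1 / q) * \<rho>) * indicator {0..1} t * indicator B w
        \<le> ennreal \<rho> * (ennreal l * indicator B w + ennreal (l powr (1 - q)) * ennreal (h (x + t *\<^sub>R (w - x))))"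
        using True by (simp split: split_indicator)
    qed
    also have "\<dots> = ennreal \<rho> * (ennreal l * emeasure lborel B
        + ennreal (l powr (1 - q)) * (\<integral>\<^sup>+w. ennreal (h (x + t *\<^sub>R (w - x))) \<partial>lborel))"
      by (simp add: nn_integral_cmult nn_integral_add nn_integral_cmult_indicator)
    also have "\<dots> \<le> ennreal \<rho> * (ennreal l * emeasure lborel B + ennreal (l powr (1 - q)) * ennreal (K / t ^ DIM('a)))"
      using h K t by (intro mult_left_mono add_left_mono nn_integral_scale_ball_le) auto
    also have "\<dots> = ennreal (\<rho> * (l * (unit_ball_vol N * d powr N) + l powr (1 - q) / t ^ DIM('a) * K))"
      using \<rho>0 l K t d by (simp add: B_def emeasure_ball N_def powr_realpow flip: ennreal_mult ennreal_plus)
    also have "\<rho> * (l * (unit_ball_vol N * d powr N) + l powr (1 - q) / t ^ DIM('a) * K)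
        = \<rho> * (unit_ball_vol N + K) * (d powr N * l)"
      unfolding lq by (simp add: algebra_simps)
    also have "d powr N * l = d powr (N - \<alpha>) * t powr - \<alpha>"
      using t d by (simp add: l_def powr_mult powr_diff powr_minus field_simps)
    finally show ?thesis
      using True \<rho>0 K N1 by (simp add: ennreal_mult[symmetric] mult.assoc)
  qed simp
  have "(\<integral>\<^sup>+w. ennreal (norm (f w - f x)) * indicator B w \<partial>lborel)
     \<le> (\<integral>\<^sup>+w. (\<integral>\<^sup>+t. ennreal (h (x + t *\<^sub>R (w - x)) powr (1 / q) * \<rho>) * indicator {0..1} t * indicator B w \<partial>lborel) \<partial>lborel)"
    by (intro nn_integral_mono pt)
  \<comment> \<open>Integrating over \<open>w\<close> first, for fixed \<open>t\<close>, is what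
    brings the dilation bound into play.\<close>
  also have "\<dots> = (\<integral>\<^sup>+t. (\<integral>\<^sup>+w. ennreal (h (x + t *\<^sub>R (w - x)) powr (1 / q) * \<rho>) * indicator {0..1} t * indicator B w \<partial>lborel) \<partial>lborel)"
    by (rule lborel_pair.Fubini') simp
  also have "\<dots> \<le> (\<integral>\<^sup>+t. ennreal (\<rho> * (unit_ball_vol N + K) * d powr (N - \<alpha>)) * (ennreal (t powr - \<alpha>) * indicator {0..1} t) \<partial>lborel)"
    using AE_lborel_singleton[of "0::real"] inner by (intro nn_integral_mono_AE) (auto elim!: eventually_mono)
  also have "\<dots> = ennreal (\<rho> * (unit_ball_vol N + K) * d powr (N - \<alpha>)) * ennreal (1 / (1 - \<alpha>))"
    using nn_integral_powr_Icc_0_1[OF \<alpha>(2)] by (simp add: nn_integral_cmult)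
  also have "\<dots> = ennreal (\<rho> * (unit_ball_vol N + K) / (1 - \<alpha>) * d powr (N - \<alpha>))"
    using \<rho>0 K \<alpha> N1 by (subst ennreal_mult[symmetric]) auto
  finally show ?thesis by (simp add: B_def \<alpha>_def)
qed


text \<open>The ball is a common meeting place: the segment from \<open>x\<close> to
  \<open>y\<close> may leave \<open>S\<close>, while those from either point to the ball do not. The
  triangle inequality through \<open>f w\<close> is integrated over \<open>w\<close> in the ball and
  divided by its volume, which turns \<open>d powr (N - N / q)\<close> into
  \<open>d powr (- (N / q))\<close>.\<close>

lemma Morrey_two_points:
  fixes f :: "'a::euclidean_space \<Rightarrow> 'b::banach" and h :: "'a \<Rightarrow> real"
  defines "N \<equiv> real DIM('a)"
  assumes q: "N < q" and d: "0 < d"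
    and \<rho>: "ball c d \<subseteq> cball x \<rho>" "ball c d \<subseteq> cball y \<rho>"
    and seg: "\<And>w. w \<in> ball c d \<Longrightarrow> closed_segment x w \<subseteq> S"
             "\<And>w. w \<in> ball c d \<Longrightarrow> closed_segment y w \<subseteq> S"
    and deriv: "\<And>z. z \<in> S \<Longrightarrow> (f has_derivative f' z) (at z)"
    and bound: "\<And>z v. z \<in> S \<Longrightarrow> norm (f' z v) \<le> h z powr (1 / q) * norm v"
    and h: "h \<in> borel_measurable borel" "\<And>z. 0 \<le> h z"
    and K: "(\<integral>\<^sup>+z. ennreal (h z) \<partial>lborel) \<le> ennreal K" "0 \<le> K"
  shows "norm (f x - f y)
     \<le> 2 * \<rho> * (unit_ball_vol N + K) / ((1 - N / q) * unit_ball_vol N) * d powr (- (N / q))"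
proof -
  define C where "C = \<rho> * (unit_ball_vol N + K) / (1 - N / q)"
  define B where "B = ball c d"
  have N1: "N \<ge> 1" using DIM_positive[where 'a='a] by (simp add: N_def Suc_le_eq)
  have vol: "unit_ball_vol N > 0" using N1 by simp
  have "c \<in> cball x \<rho>" by (rule subsetD[OF \<rho>(1)]) (use d in simp)
  then have \<rho>0: "0 \<le> \<rho>" by (metis mem_cball zero_le_dist order_trans)
  have C0: "0 \<le> C" using \<rho>0 vol K N1 q by (simp add: C_def)
  have "w \<in> S" if "w \<in> B" for w
    using seg(1)[of w] that by (auto simp: B_def)
  then have contf: "continuous_on B f"
    by (meson continuous_at_imp_continuous_on deriv has_derivative_continuous)
  have meas: "(\<lambda>w. ennreal (norm (f w - a)) * indicator B w) \<in> borel_measurable lborel" for a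
  proof -
    have "(\<lambda>w. indicator B w *\<^sub>R (f w - a)) \<in> borel_measurable borel"
      by (intro borel_measurable_continuous_on_indicator continuous_intros contf) (simp add: B_def)
    then have "(\<lambda>w. ennreal (norm (indicator B w *\<^sub>R (f w - a)))) \<in> borel_measurable borel"
      by measurable
    also have "(\<lambda>w. ennreal (norm (indicator B w *\<^sub>R (f w - a)))) = (\<lambda>w. ennreal (norm (f w - a)) * indicator B w)"
      by (auto split: split_indicator)
    finally show ?thesis by simp
  qed
  have "ennreal (norm (f x - f y)) * emeasure lborel B
      = (\<integral>\<^sup>+w. ennreal (norm (f x - f y)) * indicator B w \<partial>lborel)"
    by (simp add: nn_integral_cmult_indicator B_def)
  also have "\<dots> \<le> (\<integral>\<^sup>+w. ennreal (norm (f w - f x)) * indicator B w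
                      + ennreal (norm (f w - f y)) * indicator B w \<partial>lborel)"
  proof (rule nn_integral_mono)
    fix w
    have "norm (f x - f y) \<le> norm (f w - f x) + norm (f w - f y)"
      by (metis dist_norm dist_triangle dist_commute)
    then have "ennreal (norm (f x - f y)) \<le> ennreal (norm (f w - f x)) + ennreal (norm (f w - f y))"
      by (simp flip: ennreal_plus add: ennreal_leI)
    then show "ennreal (norm (f x - f y)) * indicator B w
      \<le> ennreal (norm (f w - f x)) * indicator B w + ennreal (norm (f w - f y)) * indicator B w"
      by (simp split: split_indicator)
  qed
  also have "\<dots> = (\<integral>\<^sup>+w. ennreal (norm (f w - f x)) * indicator B w \<partial>lborel)
                + (\<integral>\<^sup>+w. ennreal (norm (f w - f y)) * indicator B w \<partial>lborel)"
    by (intro nn_integral_add meas)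
  also have "\<dots> \<le> ennreal (C * d powr (N - N / q)) + ennreal (C * d powr (N - N / q))"
    unfolding C_def B_def N_def using q[unfolded N_def]
    by (intro add_mono Morrey_mean_bound[where S = S and f' = f' and h = h] d \<rho> seg deriv bound h K) auto
  also have "\<dots> = ennreal (2 * C * d powr (N - N / q))"
    using C0 by (simp flip: ennreal_plus)
  finally have "ennreal (norm (f x - f y)) * ennreal (unit_ball_vol N * d ^ DIM('a)) \<le> \<dots>"
    using d by (simp add: B_def emeasure_ball N_def)
  then have "ennreal (norm (f x - f y) * (unit_ball_vol N * d ^ DIM('a))) \<le> ennreal (2 * C * d powr (N - N / q))"
    using vol d by (simp add: ennreal_mult)
  then have "norm (f x - f y) * (unit_ball_vol N * d powr N) \<le> 2 * C * d powr (N - N / q)"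
    using C0 d by (subst (asm) ennreal_le_iff) (simp_all add: N_def powr_realpow)
  also have "d powr (N - N / q) = d powr N * d powr (- (N / q))"
    by (simp flip: powr_add)
  finally have "norm (f x - f y) * unit_ball_vol N \<le> 2 * C * d powr (- (N / q))"
    using d by (simp add: mult.commute mult.left_commute)
  then have "norm (f x - f y) \<le> 2 * C * d powr (- (N / q)) / unit_ball_vol N"
    using vol by (simp add: pos_le_divide_eq)
  also have "\<dots> = 2 * \<rho> * (unit_ball_vol N + K) / ((1 - N / q) * unit_ball_vol N) * d powr (- (N / q))"
    by (simp add: C_def)
  finally show ?thesis .
qed

text \<open>Two cones with the same axis \<open>e\<close> and aperture \<open>\<kappa>\<close>,
  whose vertices are at distance \<open>d\<close>, share a ball of radius \<open>d\<close> at a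
  height proportional to \<open>d\<close>. Hence the segments to it have length of order
  \<open>d\<close>, and \<open>Morrey_two_points\<close> becomes a Hoelder estimate.\<close>

lemma Morrey_uniformly_continuous_cone:
  fixes f :: "'a::euclidean_space \<Rightarrow> 'b::banach" and h :: "'a \<Rightarrow> real"
  assumes q: "real DIM('a) < q" and r: "0 < r" and \<kappa>: "0 < \<kappa>"
    and cone: "\<And>x s v. x \<in> S \<inter> ball p r \<Longrightarrow> 0 < s \<Longrightarrow> s < r \<Longrightarrow> norm (v - s *\<^sub>R e) \<le> \<kappa> * s \<Longrightarrow> x + v \<in> S"
    and deriv: "\<And>z. z \<in> S \<Longrightarrow> (f has_derivative f' z) (at z)"
    and bound: "\<And>z v. z \<in> S \<Longrightarrow> norm (f' z v) \<le> h z powr (1 / q) * norm v"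
    and h: "h \<in> borel_measurable borel" "\<And>z. 0 \<le> h z"
    and fin: "(\<integral>\<^sup>+z. ennreal (h z) \<partial>lborel) < \<infinity>"
  obtains r' where "0 < r'" "uniformly_continuous_on (S \<inter> ball p r') f"
proof -
  define N where "N = real DIM('a)"
  define \<alpha> where "\<alpha> = N / q"
  obtain K where K: "(\<integral>\<^sup>+z. ennreal (h z) \<partial>lborel) \<le> ennreal K" "0 \<le> K"
    using fin by (cases "\<integral>\<^sup>+z. ennreal (h z) \<partial>lborel") auto
  have N1: "N \<ge> 1" using DIM_positive[where 'a='a] by (simp add: N_def Suc_le_eq)
  have vol: "unit_ball_vol N > 0" using N1 by simp
  have \<alpha>: "0 < \<alpha>" "\<alpha> < 1" using N1 q by (auto simp: \<alpha>_def N_def)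
  \<comment> \<open>\<open>M * d\<close> bounds the distance from either vertex to points of the
    common ball: \<open>2 * d\<close> for the deviation from the axis, and \<open>s * norm e\<close>
    with \<open>s = 2 * d / \<kappa>\<close> for the height.\<close>
  define M where "M = 2 / \<kappa> * norm e + 2"
  have M: "M > 0" using \<kappa> by (simp add: M_def add_nonneg_pos)
  define C where "C = 2 * M * (unit_ball_vol N + K) / ((1 - \<alpha>) * unit_ball_vol N)"
  have C0: "C \<ge> 0" using M vol K \<alpha> by (simp add: C_def)
  \<comment> \<open>Points of \<open>ball p r'\<close> are less than \<open>\<kappa> * r / 2\<close>
    apart, which keeps the height \<open>s\<close> below \<open>r\<close>.\<close>
  define r' where "r' = min r (\<kappa> * r / 4)"
  have r': "0 < r'" "r' \<le> r" "r' \<le> \<kappa> * r / 4" using r \<kappa> by (auto simp: r'_def)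
  have Holder: "norm (f x - f y) \<le> C * norm (x - y) powr (1 - \<alpha>)"
    if x: "x \<in> S \<inter> ball p r'" and y: "y \<in> S \<inter> ball p r'" for x y
  proof (cases "x = y")
    case False
    define d where "d = norm (x - y)"
    have d: "0 < d" using False by (simp add: d_def)
    have "dist x y < 2 * r'"
      using x y dist_triangle2[of x y p] by (simp add: dist_commute)
    then have dr: "d < \<kappa> * r / 2" using r'(3) by (simp add: d_def dist_norm)
    define s where "s = 2 * d / \<kappa>" \<comment> \<open>puts \<open>ball (x + s *\<^sub>R e) d\<close> inside the cones at both \<open>x\<close> and \<open>y\<close>\<close>
    have s: "0 < s" "s < r" "\<kappa> * s = 2 * d" using d dr \<kappa> by (auto simp: s_def field_simps)
    define c where "c = x + s *\<^sub>R e"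
    \<comment> \<open>Cones are invariant under scaling: if \<open>w - a\<close> lies in the slice
      at height \<open>s\<close>, then \<open>t *\<^sub>R (w - a)\<close> lies in the slice at
      height \<open>t * s\<close>. The vertex, \<open>t = 0\<close>, lies in \<open>S\<close> by
      assumption.\<close>
    have star: "closed_segment a w \<subseteq> S" if a: "a \<in> S \<inter> ball p r'" and w: "norm (w - a - s *\<^sub>R e) \<le> 2 * d" for a w
    proof
      fix z assume "z \<in> closed_segment a w"
      then obtain t where t: "0 \<le> t" "t \<le> 1" and z: "z = a + t *\<^sub>R (w - a)"
        by (auto simp: closed_segment_def algebra_simps)
      show "z \<in> S"
      proof (cases "t = 0")
        case False
        with t have t0: "t > 0" by simp
        have ts: "t * s < r" using t s by (smt (verit) mult_left_le_one_le)
        have "t *\<^sub>R (w - a) - (t * s) *\<^sub>R e = t *\<^sub>R (w - a - s *\<^sub>R e)"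
          by (simp add: algebra_simps)
        then have "norm (t *\<^sub>R (w - a) - (t * s) *\<^sub>R e) = t * norm (w - a - s *\<^sub>R e)"
          using t by simp
        also have "\<dots> \<le> t * (\<kappa> * s)" using w t s by (intro mult_left_mono) auto
        finally have "norm (t *\<^sub>R (w - a) - (t * s) *\<^sub>R e) \<le> \<kappa> * (t * s)" by (simp add: mult.left_commute)
        with a r' ts t0 s show ?thesis unfolding z by (intro cone[where s = "t * s"]) auto
      qed (use a z in simp)
    qed
    have wx: "norm (w - x - s *\<^sub>R e) \<le> 2 * d" if "w \<in> ball c d" for w
      using that d by (simp add: c_def dist_norm norm_minus_commute diff_diff_eq)
    \<comment> \<open>The factor 2 in \<open>\<kappa> * s = 2 * d\<close> is consumed here: one
      \<open>d\<close> for the radius of the ball and one for the offset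
      \<open>x - y\<close>.\<close>
    have wy: "norm (w - y - s *\<^sub>R e) \<le> 2 * d" if "w \<in> ball c d" for w
    proof -
      have "w - y - s *\<^sub>R e = (w - c) + (x - y)" by (simp add: c_def)
      also have "norm \<dots> \<le> norm (w - c) + norm (x - y)" by (rule norm_triangle_ineq)
      finally show ?thesis using that by (simp add: d_def dist_norm norm_minus_commute)
    qed
    have "w \<in> cball a (M * d)" if "norm (w - a - s *\<^sub>R e) \<le> 2 * d" for a w
    proof -
      have "norm (w - a) \<le> norm (w - a - s *\<^sub>R e) + norm (s *\<^sub>R e)"
        by (metis diff_add_cancel norm_triangle_ineq)
      also have "\<dots> \<le> 2 * d + s * norm e" using that s by simp
      also have "\<dots> = M * d" by (simp add: M_def s_def field_simps)
      finally show ?thesis by (simp add: dist_norm norm_minus_commute)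
    qed
    then have "ball c d \<subseteq> cball x (M * d)" "ball c d \<subseteq> cball y (M * d)"
      using wx wy by blast+
    then have "norm (f x - f y)
       \<le> 2 * (M * d) * (unit_ball_vol N + K) / ((1 - N / q) * unit_ball_vol N) * d powr (- (N / q))"
      unfolding N_def using x y wx wy
      by (intro Morrey_two_points[where S = S and f' = f' and h = h and c = c] q d star deriv bound h K)
    also have "\<dots> = C * (d * d powr (- \<alpha>))" by (simp add: C_def \<alpha>_def)
    also have "d * d powr (- \<alpha>) = d powr (1 - \<alpha>)"
      using d by (simp add: powr_diff powr_minus field_simps)
    finally show ?thesis by (simp add: d_def)
  qed simp
  have "uniformly_continuous_on (S \<inter> ball p r') f"
    unfolding uniformly_continuous_on_def
  proof (intro allI impI)
    fix \<epsilon> :: real assume \<epsilon>: "\<epsilon> > 0"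
    \<comment> \<open>Dividing by \<open>C + 1\<close> is safe with only \<open>C \<ge> 0\<close> at
      hand, and it makes the final inequality strict.\<close>
    define \<eta> where "\<eta> = \<epsilon> / (C + 1)"
    define \<delta> where "\<delta> = \<eta> powr (1 / (1 - \<alpha>))"
    have \<eta>: "\<eta> > 0" using \<epsilon> C0 by (simp add: \<eta>_def)
    have \<delta>: "\<delta> > 0" "\<delta> powr (1 - \<alpha>) = \<eta>" using \<eta> \<alpha> by (auto simp: \<delta>_def powr_powr)
    show "\<exists>d>0. \<forall>x\<in>S \<inter> ball p r'. \<forall>x'\<in>S \<inter> ball p r'. dist x' x < d \<longrightarrow> dist (f x') (f x) < \<epsilon>"
    proof (intro exI[of _ \<delta>] conjI ballI impI \<delta>(1))
      fix x x' assume *: "x \<in> S \<inter> ball p r'" "x' \<in> S \<inter> ball p r'" "dist x' x < \<delta>"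
      have "dist (f x') (f x) \<le> C * norm (x' - x) powr (1 - \<alpha>)"
        using Holder *(1,2) by (simp add: dist_norm)
      also have "\<dots> \<le> C * \<eta>"
        unfolding \<delta>(2)[symmetric] using * \<alpha> C0
        by (intro mult_left_mono powr_mono2) (auto simp: dist_norm)
      also have "\<dots> < (C + 1) * \<eta>" using \<eta> by (simp add: algebra_simps)
      also have "\<dots> = \<epsilon>" using C0 by (simp add: \<eta>_def)
      finally show "dist (f x') (f x) < \<epsilon>" .
    qed
  qed
  with r'(1) that show ?thesis by blast
qed

section \<open>Uniform continuity from local to global\<close>

text \<open>Sequences of ever closer points violating uniform continuity have, along a subsequence,
  a common limit in the compact closure, and eventually both lie in the ball given there. Thus no
  Lebesgue number of a cover is needed to place close points in the same ball.\<close>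

lemma uniformly_continuous_on_local:
  fixes f :: "'a::heine_borel \<Rightarrow> 'b::metric_space"
  assumes bdd: "bounded S"
    and loc: "\<And>p. p \<in> closure S \<Longrightarrow> \<exists>r>0. uniformly_continuous_on (S \<inter> ball p r) f"
  shows "uniformly_continuous_on S f"
proof (rule ccontr)
  assume "\<not> uniformly_continuous_on S f"
  then obtain \<epsilon> where \<epsilon>: "\<epsilon> > 0"
    and "\<forall>d>0. \<exists>x\<in>S. \<exists>y\<in>S. dist y x < d \<and> \<not> dist (f y) (f x) < \<epsilon>"
    unfolding uniformly_continuous_on_def by blast
  then have "\<forall>n. \<exists>x y. x \<in> S \<and> y \<in> S \<and> dist y x < inverse (real (Suc n)) \<and> \<not> dist (f y) (f x) < \<epsilon>"
    by (metis inverse_positive_iff_positive of_nat_0_less_iff zero_less_Suc)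
  then obtain X Y where XY: "\<And>n. X n \<in> S" "\<And>n. Y n \<in> S"
      "\<And>n. dist (Y n) (X n) < inverse (real (Suc n))" "\<And>n. \<not> dist (f (Y n)) (f (X n)) < \<epsilon>"
    by metis
  have "compact (closure S)" using bdd by simp
  then obtain p k where p: "p \<in> closure S" "strict_mono k" "(X \<circ> k) \<longlonglongrightarrow> p"
    using XY(1) closure_subset by (metis compact_def subsetD)
  have d0: "(\<lambda>n. dist (Y n) (X n)) \<longlonglongrightarrow> 0"
    by (rule tendsto_sandwich[OF _ _ tendsto_const LIMSEQ_inverse_real_of_nat])
      (use XY(3) in \<open>auto intro!: always_eventually less_imp_le simp del: of_nat_Suc\<close>)
  then have dk: "(\<lambda>n. dist ((Y \<circ> k) n) ((X \<circ> k) n)) \<longlonglongrightarrow> 0"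
    using LIMSEQ_subseq_LIMSEQ[OF d0 p(2)] by (simp add: o_def)
  obtain r where r: "r > 0" "uniformly_continuous_on (S \<inter> ball p r) f" using loc p(1) by blast
  obtain \<delta> where \<delta>: "\<delta> > 0" "\<And>x y. x \<in> S \<inter> ball p r \<Longrightarrow> y \<in> S \<inter> ball p r \<Longrightarrow> dist y x < \<delta> \<Longrightarrow> dist (f y) (f x) < \<epsilon>"
    using r(2) \<epsilon> unfolding uniformly_continuous_on_def by metis
  have "\<forall>\<^sub>F n in sequentially. dist ((X \<circ> k) n) p < r / 2 \<and> dist ((Y \<circ> k) n) ((X \<circ> k) n) < min \<delta> (r / 2)"
    using r(1) \<delta>(1) by (intro eventually_conj tendstoD[OF p(3)] order_tendstoD(2)[OF dk]) auto
  then obtain n where n: "dist (X (k n)) p < r / 2" "dist (Y (k n)) (X (k n)) < min \<delta> (r / 2)"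
    by (auto simp: eventually_sequentially)
  then have "dist (X (k n)) p < r" "dist (Y (k n)) p < r"
    using r(1) dist_triangle[of "Y (k n)" p "X (k n)"] by auto
  then show False
    using \<delta>(2)[of "X (k n)" "Y (k n)"] XY(1,2,4) n(2) by (simp add: dist_commute)
qed


lemma uniformly_continuous_on_mono:
  fixes f :: "'a::metric_space \<Rightarrow> 'b::metric_space"
  assumes "uniformly_continuous_on T f" "S \<subseteq> T"
  shows "uniformly_continuous_on S f"
  unfolding uniformly_continuous_on_def
proof (intro allI impI)
  fix \<epsilon> :: real assume "\<epsilon> > 0"
  with assms(1) obtain d where "d > 0" "\<forall>x\<in>T. \<forall>y\<in>T. dist y x < d \<longrightarrow> dist (f y) (f x) < \<epsilon>"
    unfolding uniformly_continuous_on_def by meson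
  with assms(2) show "\<exists>d>0. \<forall>x\<in>S. \<forall>y\<in>S. dist y x < d \<longrightarrow> dist (f y) (f x) < \<epsilon>"
    by (intro exI[of _ d]) auto
qed

section \<open>Unitary coordinates and the interior cone of a Lipschitz boundary\<close>

lemma norm_unitary_map:
  assumes "unitary_map A"
  shows "norm (A z) = norm z"
proof -
  have *: "(\<Sum>j\<in>UNIV. w $ j * cnj (w $ j)) = complex_of_real ((norm w)\<^sup>2)" for w :: "complex ^ 'n"
    by (simp add: norm_vec_def L2_set_def sum_nonneg complex_norm_square del: of_real_power)
  have "complex_of_real ((norm (A z))\<^sup>2) = complex_of_real ((norm z)\<^sup>2)"
    unfolding *[symmetric] using assms by (simp add: unitary_map_def)
  then show ?thesis by (simp only: of_real_eq_iff) simp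
qed

lemma scaleR_eq_vector_scalar_mult: "c *\<^sub>R (z :: complex ^ 'n) = complex_of_real c *s z"
  by (simp add: vec_eq_iff) (simp add: scaleR_conv_of_real)

lemma complex_linear_imp_linear:
  assumes "Vector_Spaces.linear (*s) (*s) (A :: complex ^ 'n \<Rightarrow> complex ^ 'm)"
  shows "linear A"
proof -
  interpret A: Vector_Spaces.linear "(*s)" "(*s)" A by (rule assms)
  show ?thesis
    by (rule linearI) (simp_all add: A.add scaleR_eq_vector_scalar_mult A.scale)
qed

lemma flat_add: "flat k (z + w) = flat k z + flat k w"
  by (simp add: flat_def vec_eq_iff)

lemma norm_flat_le: "norm (flat k z) \<le> norm z"
  unfolding norm_vec_def
  by (rule L2_set_mono) (auto simp: flat_def abs_Re_le_cmod)

text \<open>Starting above the graph of an \<open>L\<close>-Lipschitz function and moving up by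
  \<open>s\<close> with an error of at most \<open>\<kappa> * s\<close>, the point rises by at least
  \<open>s - \<kappa> * s\<close> and the graph by at most \<open>L * \<kappa> * s\<close>. Since
  \<open>A\<close> preserves norms, the vertical cone pulls back to a cone with the same aperture
  around \<open>e\<close>.\<close>

lemma Lipschitz_manifold_boundary_cone:
  fixes G :: "(complex ^ 'n) set"
  assumes G: "Lipschitz_manifold_boundary G" and p: "p \<in> frontier G"
  obtains e \<kappa> r where "0 < \<kappa>" "0 < r"
    "\<And>x s v. x \<in> G \<inter> ball p r \<Longrightarrow> 0 < s \<Longrightarrow> s < r \<Longrightarrow> norm (v - s *\<^sub>R e) \<le> \<kappa> * s \<Longrightarrow> x + v \<in> G"
proof -
  obtain V A k P \<phi> L where V: "open V" "p \<in> V" and A: "unitary_map A"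
    and P: "openin (top_of_set {w. Im (w $ k) = 0}) P" "0 \<in> P"
    and L: "L-lipschitz_on P \<phi>"
    and graph: "(\<lambda>z. A (z - p)) ` (V \<inter> G) =
          {w \<in> (\<lambda>z. A (z - p)) ` V. flat k w \<in> P \<and> Im (w $ k) > \<phi> (flat k w)}"
    using bspec[OF G[unfolded Lipschitz_manifold_boundary_def] p] by auto
  have L0: "L \<ge> 0" using L by (rule lipschitz_on_nonneg)
  have linA: "linear A"
    using A by (simp add: unitary_map_def complex_linear_imp_linear)
  have injA: "inj A"
    using linear_injective_0[OF linA] norm_unitary_map[OF A] by (metis norm_eq_zero)
  then have "surj A" using linA by (simp add: linear_injective_imp_surjective)
  then obtain e where e: "A e = axis k \<i>" by (metis surjD)
  obtain \<epsilon>1 where \<epsilon>1: "\<epsilon>1 > 0" "ball p \<epsilon>1 \<subseteq> V" using V by (meson open_contains_ball)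
  obtain \<epsilon>2 where \<epsilon>2: "\<epsilon>2 > 0" "ball 0 \<epsilon>2 \<inter> {w. Im (w $ k) = 0} \<subseteq> P"
    using P by (meson openin_contains_ball)
  have flatP: "flat k w \<in> P" if "norm w < \<epsilon>2" for w
    using that norm_flat_le[of k w] by (intro subsetD[OF \<epsilon>2(2)]) (auto simp: flat_def)
  \<comment> \<open>With this value \<open>L * \<kappa> + \<kappa> = (L + 1) / (L + 2)\<close>,
    which stays below 1 for every \<open>L \<ge> 0\<close>.\<close>
  define \<kappa> where "\<kappa> = 1 / (2 + L)"
  have \<kappa>: "0 < \<kappa>" "\<kappa> \<le> 1 / 2" "L * \<kappa> + \<kappa> < 1" using L0 by (auto simp: \<kappa>_def field_simps)
  \<comment> \<open>A displacement \<open>v\<close> in the cone is shorter than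
    \<open>2 * r\<close>, so \<open>x + v\<close> stays within \<open>4 * r\<close> of
    \<open>p\<close>: inside \<open>V\<close>, and with its flattened coordinates in the domain
    \<open>P\<close> of the graph function.\<close>
  define r where "r = min \<epsilon>1 \<epsilon>2 / 4"
  have r: "0 < r" "4 * r \<le> \<epsilon>1" "4 * r \<le> \<epsilon>2" using \<epsilon>1 \<epsilon>2 by (auto simp: r_def)
  have "x + v \<in> G" if x: "x \<in> G \<inter> ball p r" and s: "0 < s" "s < r" and v: "norm (v - s *\<^sub>R e) \<le> \<kappa> * s" for x s v
  proof -
    define w where "w = A (x - p)"
    define u where "u = A v"
    have wu: "A (x + v - p) = w + u"
      by (simp add: w_def u_def algebra_simps flip: linear_add[OF linA])
    have "norm e = 1" using norm_unitary_map[OF A, of e] by (simp add: e norm_eq_sqrt_inner inner_axis_axis inner_complex_def)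
    then have "norm v \<le> \<kappa> * s + s"
      using norm_triangle_ineq[of "v - s *\<^sub>R e" "s *\<^sub>R e"] v s by simp
    also have "\<kappa> * s \<le> s" using \<kappa> s by (simp add: mult_le_cancel_right1)
    finally have nv: "norm v < 2 * r" using s by simp
    have nx: "norm (x - p) < r" using x by (simp add: dist_norm norm_minus_commute)
    have nxv: "norm (x + v - p) < 4 * r"
      using norm_triangle_ineq[of "x - p" v] nv nx r(1) by (simp add: add_diff_eq diff_add_eq)
    have inV: "x \<in> V" "x + v \<in> V"
      using nx nxv r by (auto intro!: subsetD[OF \<epsilon>1(2)] simp: dist_norm norm_minus_commute)
    have nw: "norm w < \<epsilon>2" "norm (w + u) < \<epsilon>2"
      unfolding wu[symmetric] unfolding w_def norm_unitary_map[OF A] using nx nxv r by auto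
    have "w \<in> (\<lambda>z. A (z - p)) ` (V \<inter> G)" using x inV by (auto simp: w_def)
    then have Imw: "Im (w $ k) > \<phi> (flat k w)" unfolding graph by simp
    have du: "norm (u - s *\<^sub>R axis k \<i>) \<le> \<kappa> * s"
    proof -
      have "u - s *\<^sub>R axis k \<i> = A (v - s *\<^sub>R e)"
        by (simp add: u_def linear_diff[OF linA] linear_scale[OF linA] e)
      then show ?thesis using v norm_unitary_map[OF A] by simp
    qed
    \<comment> \<open>\<open>flat k\<close> annihilates the vertical direction
      \<open>axis k \<i>\<close>, so only the error term moves the argument of
      \<open>\<phi>\<close>.\<close>
    have "flat k u = flat k (u - s *\<^sub>R axis k \<i>)"
      by (simp add: flat_def vec_eq_iff axis_def)
    then have fu: "norm (flat k u) \<le> \<kappa> * s" using norm_flat_le du by (metis order_trans)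
    have "s - Im (u $ k) \<le> \<bar>Im ((u - s *\<^sub>R axis k \<i>) $ k)\<bar>"
      by (simp add: axis_def)
    also have "\<dots> \<le> norm (u - s *\<^sub>R axis k \<i>)"
      by (rule order_trans[OF abs_Im_le_cmod Finite_Cartesian_Product.norm_nth_le])
    finally have Imu: "Im (u $ k) \<ge> s - \<kappa> * s" using du by simp
    have "\<phi> (flat k (w + u)) - \<phi> (flat k w) \<le> L * norm (flat k u)"
      using lipschitz_onD[OF L flatP flatP, OF nw(2,1)] by (simp add: dist_norm flat_add)
    also have "\<dots> \<le> L * (\<kappa> * s)" using fu L0 by (rule mult_left_mono)
    also have "\<dots> < s - \<kappa> * s"
    proof -
      have "(L * \<kappa> + \<kappa>) * s < 1 * s" using \<kappa>(3) s(1) by (intro mult_strict_right_mono)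
      then show ?thesis by (simp add: algebra_simps)
    qed
    finally have "\<phi> (flat k (w + u)) < Im ((w + u) $ k)" using Imw Imu by simp
    moreover have "w + u \<in> (\<lambda>z. A (z - p)) ` V" using inV by (auto simp flip: wu)
    ultimately have "w + u \<in> (\<lambda>z. A (z - p)) ` (V \<inter> G)"
      unfolding graph using flatP[OF nw(2)] by simp
    then obtain z where "z \<in> G" "A (z - p) = A (x + v - p)" by (auto simp: wu)
    then show ?thesis using injD[OF injA] by fastforce
  qed
  with \<kappa>(1) r(1) that show ?thesis by blast
qed

section \<open>A Borel majorant of the gradient with finite integral\<close>

text \<open>The derivative is a pointwise limit of difference quotients with steps
  \<open>1 / (n + 1)\<close>. Extending \<open>f\<close> by 0 makes these quotients Borel on the
  whole space, and near a point of the open set \<open>S\<close> the extension agrees with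
  \<open>f\<close>. Borel measurability is what the exchange of integrals over \<open>lborel\<close>
  in Morrey's estimate asks for.\<close>

lemma borel_measurable_directional_derivative:
  fixes f :: "'a::euclidean_space \<Rightarrow> 'b::euclidean_space"
  assumes S: "open S" and deriv: "\<And>z. z \<in> S \<Longrightarrow> (f has_derivative f' z) (at z)"
  shows "(\<lambda>z. indicator S z *\<^sub>R f' z v) \<in> borel_measurable borel"
proof -
  define g where "g z = indicator S z *\<^sub>R f z" for z
  have "continuous_on S f"
    by (meson continuous_at_imp_continuous_on deriv has_derivative_continuous)
  then have [measurable]: "g \<in> borel_measurable borel"
    unfolding g_def using S by (intro borel_measurable_continuous_on_indicator) auto
  have [measurable]: "S \<in> sets borel" using S by simp
  show ?thesis
  proof (rule borel_measurable_LIMSEQ_metric)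
    fix n :: nat
    show "(\<lambda>z. indicator S z *\<^sub>R (g (z + inverse (real (Suc n)) *\<^sub>R v) - g z) /\<^sub>R inverse (real (Suc n))) \<in> borel_measurable borel"
      by measurable
  next
    fix z :: 'a
    show "(\<lambda>n. indicator S z *\<^sub>R (g (z + inverse (real (Suc n)) *\<^sub>R v) - g z) /\<^sub>R inverse (real (Suc n)))
       \<longlonglongrightarrow> indicator S z *\<^sub>R f' z v"
    proof (cases "z \<in> S")
      case True
      have "(g has_derivative f' z) (at z)"
        by (rule has_derivative_transform_within_open[OF deriv[OF True] S True]) (simp add: g_def)
      then have g': "(g has_derivative f' z) (at (z + 0 *\<^sub>R v))" by simp
      have "((\<lambda>t. z + t *\<^sub>R v) has_derivative (\<lambda>t. t *\<^sub>R v)) (at 0)"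
        by (auto intro!: derivative_eq_intros)
      from diff_chain_at[OF this g'] have "((\<lambda>t. g (z + t *\<^sub>R v)) has_derivative (\<lambda>t. f' z (t *\<^sub>R v))) (at 0)"
        by (simp add: o_def)
      moreover have "f' z (t *\<^sub>R v) = t *\<^sub>R f' z v" for t
        using deriv[OF True] by (meson has_derivative_linear linear_cmul)
      ultimately have "((\<lambda>t. norm (g (z + t *\<^sub>R v) - g z - t *\<^sub>R f' z v) / \<bar>t\<bar>) \<longlongrightarrow> 0) (at 0)"
        by (simp add: has_derivative_at)
      moreover have "norm (g (z + t *\<^sub>R v) - g z - t *\<^sub>R f' z v) / \<bar>t\<bar>
          = norm ((g (z + t *\<^sub>R v) - g z) /\<^sub>R t - f' z v)" if "t \<noteq> 0" for t
      proof -
        have "(g (z + t *\<^sub>R v) - g z) /\<^sub>R t - f' z v = (g (z + t *\<^sub>R v) - g z - t *\<^sub>R f' z v) /\<^sub>R t"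
          using that by (simp add: algebra_simps)
        then show ?thesis by (simp add: divide_inverse mult.commute)
      qed
      ultimately have "((\<lambda>t. norm ((g (z + t *\<^sub>R v) - g z) /\<^sub>R t - f' z v)) \<longlongrightarrow> 0) (at 0)"
        by (simp cong: Lim_cong_within)
      then have "((\<lambda>t. (g (z + t *\<^sub>R v) - g z) /\<^sub>R t) \<longlongrightarrow> f' z v) (at 0)"
        by (simp add: tendsto_norm_zero_iff LIM_zero_iff)
      moreover have "filterlim (\<lambda>n. inverse (real (Suc n))) (at 0) sequentially"
        by (rule filterlim_atI[OF LIMSEQ_inverse_real_of_nat]) simp
      ultimately show ?thesis
        using True by (auto dest: filterlim_compose)
    qed simp
  qed
qed


text \<open>A comparison through the largest term; the constant is crude because only finiteness of
  an integral depends on it.\<close>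

lemma sum_powr_le:
  fixes a :: "'i \<Rightarrow> real"
  assumes I: "finite I" and a: "\<And>i. i \<in> I \<Longrightarrow> 0 \<le> a i" and q: "0 < q"
  shows "(\<Sum>i\<in>I. a i) powr q \<le> real (card I) powr q * (\<Sum>i\<in>I. a i powr q)"
proof (cases "I = {}")
  case False
  obtain k where k: "k \<in> I" "\<And>i. i \<in> I \<Longrightarrow> a i \<le> a k"
    using Max_in[of "a ` I"] Max_ge[of "a ` I"] I False by (metis (no_types, lifting) finite_imageI image_iff imageI image_is_empty)
  have "(\<Sum>i\<in>I. a i) powr q \<le> (real (card I) * a k) powr q"
    using k a q by (intro powr_mono2 sum_bounded_above sum_nonneg) auto
  also have "\<dots> = real (card I) powr q * a k powr q"
    using a k by (simp add: powr_mult)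
  also have "\<dots> \<le> real (card I) powr q * (\<Sum>i\<in>I. a i powr q)"
    using k I by (intro mult_left_mono member_le_sum) auto
  finally show ?thesis .
qed (use q in simp)

lemma complex_linear_expansion:
  assumes "Vector_Spaces.linear (*s) (*s) (A :: complex ^ 'm \<Rightarrow> complex ^ 'n)"
  shows "A v = (\<Sum>j\<in>UNIV. v $ j *s A (axis j 1))"
proof -
  interpret A: Vector_Spaces.linear "(*s)" "(*s)" A by (rule assms)
  have "v = (\<Sum>j\<in>UNIV. v $ j *s axis j 1)"
    by (simp add: basis_expansion)
  then have "A v = A (\<Sum>j\<in>UNIV. v $ j *s axis j 1)" by simp
  then show ?thesis by (simp add: A.sum A.scale)
qed

text \<open>By complex linearity the \<open>\<i>\<close> direction contributes
  \<open>- \<i> * \<i> = 1\<close> times the real one, so the two halves of \<open>wirt\<close> add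
  up to the complex partial derivative.\<close>

lemma wirt_component:
  assumes F: "(F has_derivative A) (at z)" and A: "Vector_Spaces.linear (*s) (*s) A"
  shows "wirt j (\<lambda>w. F w $ \<mu>) z = A (axis j 1) $ \<mu>"
proof -
  interpret A: Vector_Spaces.linear "(*s)" "(*s)" A by (rule A)
  have "((\<lambda>w. F w $ \<mu>) has_derivative (\<lambda>v. A v $ \<mu>)) (at z)"
    using F by (rule bounded_linear.has_derivative[OF bounded_linear_vec_nth])
  then have eq: "frechet_derivative (\<lambda>w. F w $ \<mu>) (at z) = (\<lambda>v. A v $ \<mu>)"
    by (metis frechet_derivative_at)
  have "axis j \<i> = \<i> *s (axis j 1 :: complex ^ 'a)"
    by (simp add: vec_eq_iff axis_def)
  then have "A (axis j \<i>) $ \<mu> = \<i> * A (axis j 1) $ \<mu>"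
    by (simp add: A.scale)
  then show ?thesis by (simp add: wirt_def eq)
qed

lemma norm_complex_linear_le:
  assumes "Vector_Spaces.linear (*s) (*s) (A :: complex ^ 'm \<Rightarrow> complex ^ 'n)"
  shows "norm (A v) \<le> (\<Sum>(j, \<mu>)\<in>UNIV. cmod (A (axis j 1) $ \<mu>)) * norm v"
proof -
  have "norm (A v) \<le> (\<Sum>\<mu>\<in>UNIV. cmod (A v $ \<mu>))"
    unfolding norm_vec_def by (rule L2_set_le_sum) simp
  also have "\<dots> \<le> (\<Sum>\<mu>\<in>UNIV. \<Sum>j\<in>UNIV. cmod (A (axis j 1) $ \<mu>) * norm v)"
  proof (rule sum_mono)
    fix \<mu>
    have "cmod (A v $ \<mu>) = cmod (\<Sum>j\<in>UNIV. v $ j * A (axis j 1) $ \<mu>)"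
      by (subst complex_linear_expansion[OF assms]) simp
    also have "\<dots> \<le> (\<Sum>j\<in>UNIV. cmod (v $ j * A (axis j 1) $ \<mu>))"
      by (rule norm_sum)
    also have "\<dots> \<le> (\<Sum>j\<in>UNIV. cmod (A (axis j 1) $ \<mu>) * norm v)"
      by (intro sum_mono) (simp add: norm_mult mult.commute[of _ "norm v"] mult_right_mono Finite_Cartesian_Product.norm_nth_le)
    finally show "cmod (A v $ \<mu>) \<le> (\<Sum>j\<in>UNIV. cmod (A (axis j 1) $ \<mu>) * norm v)" .
  qed
  also have "\<dots> = (\<Sum>(j, \<mu>)\<in>UNIV. cmod (A (axis j 1) $ \<mu>)) * norm v"
    by (subst sum.swap) (simp add: sum_distrib_right sum.cartesian_product UNIV_Times_UNIV split_def)
  finally show ?thesis .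
qed


text \<open>This brings the hypothesis into the form Morrey's estimate takes: \<open>h\<close> is
  the \<open>q\<close>-th power of the sum of the moduli of all partial derivatives, cut off outside
  \<open>D\<close> so that it can be integrated over the whole space.\<close>

lemma holomorphic_gradient_dominated:
  fixes D :: "(complex ^ 'm) set" and F :: "complex ^ 'm \<Rightarrow> complex ^ 'n"
  assumes D: "open D" and F': "\<And>z. z \<in> D \<Longrightarrow> (F has_derivative F' z) (at z)"
      "\<And>z. z \<in> D \<Longrightarrow> Vector_Spaces.linear (*s) (*s) (F' z)"
    and Lp: "\<exists>p > real CARD('m). \<forall>(j::'m) (k::'m) (\<mu>::'n) (\<nu>::'n).
           L_p_on p D (\<lambda>z. wirt j (\<lambda>w. F w $ \<mu>) z * cnj (wirt k (\<lambda>w. F w $ \<nu>) z))"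
  obtains q and h :: "complex ^ 'm \<Rightarrow> real"
  where "real DIM(complex ^ 'm) < q" "h \<in> borel_measurable borel" "\<And>z. 0 \<le> h z"
    "\<And>z v. z \<in> D \<Longrightarrow> norm (F' z v) \<le> h z powr (1 / q) * norm v"
    "(\<integral>\<^sup>+z. ennreal (h z) \<partial>lborel) < \<infinity>"
proof -
  obtain p where p: "p > real CARD('m)"
    and int: "\<And>(j::'m) (k::'m) (\<mu>::'n) (\<nu>::'n). integrable (lebesgue_on D)
       (\<lambda>z. cmod (wirt j (\<lambda>w. F w $ \<mu>) z * cnj (wirt k (\<lambda>w. F w $ \<nu>) z)) powr p)"
    using Lp unfolding L_p_on_def by blast
  define q where "q = 2 * p"
  have q: "real DIM(complex ^ 'm) < q" "0 < q" using p by (auto simp: q_def DIM_cart intro: le_less_trans[OF of_nat_0_le_iff])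
  have [measurable]: "D \<in> sets borel" using D by simp
  \<comment> \<open>The indicator is essential: nothing is known about \<open>F\<close> or its
    derivative outside \<open>D\<close>.\<close>
  define a where "a i z = (case i of (j, \<mu>) \<Rightarrow> cmod (indicator D z *\<^sub>R F' z (axis j 1) $ \<mu>))"
    for i :: "'m \<times> 'n" and z
  define h where "h z = (\<Sum>i\<in>UNIV. a i z) powr q" for z
  have [measurable]: "a i \<in> borel_measurable borel" for i
  proof (cases i)
    case (Pair j \<mu>)
    have "(\<lambda>z. indicator D z *\<^sub>R (\<lambda>v. F' z v $ \<mu>) (axis j 1)) \<in> borel_measurable borel"
      by (rule borel_measurable_directional_derivative[OF D, where f = "\<lambda>z. F z $ \<mu>"])
        (rule bounded_linear.has_derivative[OF bounded_linear_vec_nth F'(1)])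
    then have "(\<lambda>z. cmod (indicator D z *\<^sub>R F' z (axis j 1) $ \<mu>)) \<in> borel_measurable borel"
      by measurable
    then show ?thesis by (simp add: Pair a_def[abs_def])
  qed
  have a0: "0 \<le> a i z" for i z by (simp add: a_def split: prod.split)
  have meas: "h \<in> borel_measurable borel" unfolding h_def by measurable
  have bound: "norm (F' z v) \<le> h z powr (1 / q) * norm v" if "z \<in> D" for z v
  proof -
    have "(\<Sum>(j, \<mu>)\<in>UNIV. cmod (F' z (axis j 1) $ \<mu>)) = (\<Sum>i\<in>UNIV. a i z)"
      using that by (intro sum.cong) (auto simp: a_def)
    also have "\<dots> = h z powr (1 / q)"
      using q a0 by (simp add: h_def powr_powr sum_nonneg)
    finally show ?thesis using norm_complex_linear_le[OF F'(2)[OF that], of v] by simp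
  qed
  \<comment> \<open>\<open>g\<close> is written with \<open>wirt\<close> to match the hypothesis.
    Being uncontrolled outside \<open>D\<close>, it dominates \<open>h\<close> only on
    \<open>D\<close>; elsewhere \<open>h\<close> is 0.\<close>
  define g where "g z = real CARD('m \<times> 'n) powr q * (\<Sum>(j, \<mu>)\<in>UNIV.
     cmod (wirt j (\<lambda>w. F w $ \<mu>) z * cnj (wirt j (\<lambda>w. F w $ \<mu>) z)) powr p)" for z
  have g0: "0 \<le> g z" for z by (auto simp: g_def intro!: mult_nonneg_nonneg sum_nonneg)
  have hg: "h z \<le> g z" if "z \<in> D" for z
  proof -
    have "a (j, \<mu>) z powr q = cmod (wirt j (\<lambda>w. F w $ \<mu>) z * cnj (wirt j (\<lambda>w. F w $ \<mu>) z)) powr p" for j \<mu>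
      using that wirt_component[OF F'(1,2)[OF that], of j \<mu>]
      by (simp add: a_def norm_mult q_def powr_mult powr_add[symmetric])
    then have "g z = real CARD('m \<times> 'n) powr q * (\<Sum>i\<in>UNIV. a i z powr q)"
      by (auto simp: g_def intro!: sum.cong)
    then show ?thesis unfolding h_def using sum_powr_le[of UNIV "\<lambda>i. a i z" q] a0 q by simp
  qed
  have h_out: "h z = 0" if "z \<notin> D" for z
    using that by (simp add: h_def a_def split_def)
  have int_g: "integrable (lebesgue_on D) g"
    unfolding g_def split_def by (intro integrable_mult_right Bochner_Integration.integrable_sum int)
  have "(\<integral>\<^sup>+z. ennreal (h z) \<partial>lborel) = (\<integral>\<^sup>+z. ennreal (h z) \<partial>lebesgue)"
    by (simp add: nn_integral_completion)
  also have "\<dots> \<le> (\<integral>\<^sup>+z. ennreal (g z) * indicator D z \<partial>lebesgue)"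
    by (intro nn_integral_mono) (auto simp: hg h_out ennreal_leI split: split_indicator)
  also have "\<dots> = (\<integral>\<^sup>+z. ennreal (g z) \<partial>lebesgue_on D)"
    by (subst nn_integral_restrict_space) auto
  also have "\<dots> = ennreal (\<integral>z. g z \<partial>lebesgue_on D)"
    using g0 by (intro nn_integral_eq_integral int_g) auto
  also have "\<dots> < \<infinity>" by simp
  finally show ?thesis using that q(1) meas bound by (simp add: h_def)
qed

section \<open>Extension to the closure and boundary values\<close>

theorem theorem1p6:
  fixes D :: "(complex ^ 'm) set"
    and \<Omega> :: "(complex ^ 'n) set"
    and F :: "complex ^ 'm \<Rightarrow> complex ^ 'n"
  assumes "CARD('m) < CARD('n)"
    and "strongly_hyperconvex_Lipschitz D"
    and "Lipschitz_manifold_boundary D"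
    and "regular_strongly_hyperconvex_Lipschitz \<Omega>"
    and "Lipschitz_manifold_boundary \<Omega>"
    and "F ` D \<subseteq> \<Omega>"
    and "holomorphic_map_on D F"
    and "proper_map (top_of_set D) (top_of_set \<Omega>) F"
    and "\<exists>p > real CARD('m). \<forall>(j::'m) (k::'m) (\<mu>::'n) (\<nu>::'n).
           L_p_on p D (\<lambda>z. wirt j (\<lambda>w. F w $ \<mu>) z * cnj (wirt k (\<lambda>w. F w $ \<nu>) z))"
  shows "\<exists>Ft. continuous_on (closure D) Ft \<and> Ft ` closure D \<subseteq> closure \<Omega> \<and>
           (\<forall>z\<in>D. Ft z = F z) \<and> Ft ` frontier D \<subseteq> frontier \<Omega>"
proof -
  have D: "open D" "bounded D"
    using assms(2) by (auto simp: strongly_hyperconvex_Lipschitz_def bounded_proper_domain_def)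
  have \<Omega>: "open \<Omega>"
    using assms(4) by (auto simp: regular_strongly_hyperconvex_Lipschitz_def bounded_proper_domain_def)
  obtain F' where F': "\<And>z. z \<in> D \<Longrightarrow> (F has_derivative F' z) (at z)"
      "\<And>z. z \<in> D \<Longrightarrow> Vector_Spaces.linear (*s) (*s) (F' z)"
    using assms(7) unfolding holomorphic_map_on_def by metis
  have contF: "continuous_on D F"
    by (meson F'(1) continuous_at_imp_continuous_on has_derivative_continuous)
  have "uniformly_continuous_on D F"
  proof (rule uniformly_continuous_on_local[OF D(2)])
    fix x assume x: "x \<in> closure D"
    show "\<exists>r>0. uniformly_continuous_on (D \<inter> ball x r) F"
    proof (cases "x \<in> D")
      case True
      then obtain r where r: "r > 0" "cball x r \<subseteq> D" using D(1) open_contains_cball by blast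
      then have "uniformly_continuous_on (cball x r) F"
        by (intro compact_uniformly_continuous continuous_on_subset[OF contF]) auto
      then have "uniformly_continuous_on (D \<inter> ball x r) F"
        by (rule uniformly_continuous_on_mono) auto
      with r(1) show ?thesis by blast
    next
      case False
      with x D(1) have fr: "x \<in> frontier D" by (simp add: frontier_def interior_open)
      obtain e \<kappa> r where
        cone: "0 < \<kappa>" "0 < r" "\<And>y s v. y \<in> D \<inter> ball x r \<Longrightarrow> 0 < s \<Longrightarrow> s < r \<Longrightarrow>
          norm (v - s *\<^sub>R e) \<le> \<kappa> * s \<Longrightarrow> y + v \<in> D"
        by (rule Lipschitz_manifold_boundary_cone[OF assms(3) fr]) (rule that)
      obtain q h where q: "real DIM(complex ^ 'm) < q" "h \<in> borel_measurable borel" "\<And>z. 0 \<le> h z"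
        "\<And>z v. z \<in> D \<Longrightarrow> norm (F' z v) \<le> h z powr (1 / q) * norm v"
        "(\<integral>\<^sup>+z. ennreal (h z) \<partial>lborel) < \<infinity>"
        by (rule holomorphic_gradient_dominated[OF D(1) F' assms(9)]) (assumption | rule that)+
      show ?thesis
        by (rule Morrey_uniformly_continuous_cone[OF q(1) cone(2,1,3) F'(1) q(4,2,3,5)]) auto
    qed
  qed
  then obtain Ft where Ft: "uniformly_continuous_on (closure D) Ft" "\<And>z. z \<in> D \<Longrightarrow> F z = Ft z"
    by (rule uniformly_continuous_on_extension_on_closure) (rule that, assumption, blast)
  have cont: "continuous_on (closure D) Ft" using Ft(1) by (rule uniformly_continuous_imp_continuous)
  have "Ft ` D \<subseteq> closure \<Omega>" using assms(6) Ft(2) closure_subset by fastforce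
  then have sub: "Ft ` closure D \<subseteq> closure \<Omega>"
    by (intro image_closure_subset cont closed_closure)
  \<comment> \<open>If \<open>Ft x\<close> were in \<open>\<Omega>\<close>, a closed ball around it
    inside \<open>\<Omega>\<close> would have a compact preimage \<open>K\<close> in
    \<open>D\<close>. A sequence in \<open>D\<close> tending to \<open>x\<close> is eventually in
    \<open>K\<close>, so \<open>x\<close> would be in \<open>K\<close> and hence in the open set
    \<open>D\<close>, against \<open>x\<close> being a frontier point.\<close>
  have "Ft x \<notin> \<Omega>" if x: "x \<in> frontier D" for x
  proof
    assume "Ft x \<in> \<Omega>"
    then obtain \<epsilon> where \<epsilon>: "\<epsilon> > 0" "cball (Ft x) \<epsilon> \<subseteq> \<Omega>" using \<Omega> open_contains_cball by blast
    define K where "K = {z \<in> D. F z \<in> cball (Ft x) \<epsilon>}"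
    have K: "compact K"
      using assms(8)[unfolded proper_map_iff_compact_preimage[OF contF assms(6)]] \<epsilon>(2)
      unfolding K_def by (metis compact_cball)
    have xc: "x \<in> closure D" "x \<notin> D" using x D(1) by (auto simp: frontier_def interior_open)
    then obtain X where X: "\<And>n. X n \<in> D" "X \<longlonglongrightarrow> x" unfolding closure_sequential by blast
    have "(\<lambda>n. Ft (X n)) \<longlonglongrightarrow> Ft x"
      by (rule continuous_on_tendsto_compose[OF cont X(2) xc(1)])
        (rule always_eventually, use X(1) closure_subset[of D] in blast)
    from tendstoD[OF this \<epsilon>(1)] have "\<forall>\<^sub>F n in sequentially. X n \<in> K"
      by eventually_elim (use X(1) Ft(2) in \<open>auto simp: K_def dist_commute intro: less_imp_le\<close>)
    then have "x \<in> K"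
      using Lim_in_closed_set[OF compact_imp_closed[OF K] _ _ X(2)] by simp
    then show False using xc by (simp add: K_def)
  qed
  moreover have "frontier D \<subseteq> closure D" by (simp add: frontier_def)
  ultimately have "Ft ` frontier D \<subseteq> frontier \<Omega>"
    using sub \<Omega> by (auto simp: frontier_def interior_open)
  with cont sub Ft(2) show ?thesis by (intro exI[of _ Ft]) auto
qed

end
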